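(* Let $G=(\mathcal V,\mathcal E)$ be a finite undirected graph with finite label sets and potentials $\theta$. Let $A^\ast_{strong}\subset\mathcal V$ and $x^0\in X_{A^\ast_{strong}}$ be such that $$\delta(x^0)\in\operatorname*{arg\,min}_{\mu\in\Lambda_{A^\ast_{strong}}}\hat E_{A^\ast_{strong},x^0}(\mu)$$ and $x^0$ is the unique such labeling on $A^\ast_{strong}$. Then the pruning algorithm described in the context finds a persistent labeling on a set $A^\ast$ such that $A^\ast_{strong}\subset A^\ast\subset\mathcal V$, i.e. $A^\ast$ is a superset of all sets on which strongly persistent labelings identifiable by the relaxed criterion exist.
   Context: For $A\subset\mathcal V$, $X_A=\prod_{v\in A}X_v$, where $X_v$ is the finite label set of node $v$; $\theta_u:X_u\to\mathbb R$ and $\theta_{uv}:X_u\times X_v\to\mathbb R$ are the unary and pairwise potentials (edges are undirected, so $\theta_{uv}(x_u,x_v)$ and $\theta_{vu}(x_v,x_u)$ denote the same number). $E_A(x)=\sum_{u\in A}\theta_u(x_u)+\sum_{uv\in\mathcal E:\,u,v\in A}\theta_{uv}(x_u,x_v)$. Boundary nodes: $\partial\mathcal V_A=\{u\in A:\exists v\in\mathcal V\setminus A,\ uv\in\mathcal E\}$; boundary edges: $\partial\mathcal E_A=\{uv\in\mathcal E:u\in A,\ v\in\mathcal V\setminus A\}$. For $uv\in\partial\mathcal E_A$ with $u\in\partial\mathcal V_A$ and a test label $y_u$: $\hat\theta_{uv,y_u}(x_u)=\max_{x_v\in X_v}\theta_{uv}(x_u,x_v)$ if $x_u=y_u$, and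 $\hat\theta_{uv,y_u}(x_u)=\min_{x_v\in X_v}\theta_{uv}(x_u,x_v)$ if $x_u\neq y_u$. $\hat E_{A,y}(x)=E_A(x)+\sum_{uv\in\partial\mathcal E_A:\,u\in\partial\mathcal V_A}\hat\theta_{uv,y_u}(x_u)$ (only the restriction of $y$ to $\partial\mathcal V_A$ matters). The local polytope $\Lambda_A$ is the set of nonnegative vectors $\mu$ with components $\mu_v(x_v)$ ($v\in A$, $x_v\in X_v$) and $\mu_{uv}(x_u,x_v)$ ($uv\in\mathcal E$, $u,v\in A$) such that $\sum_{x_v\in X_v}\mu_v(x_v)=1$, $\sum_{x_v\in X_v}\mu_{uv}(x_u,x_v)=\mu_u(x_u)$ and $\sum_{x_u\in X_u}\mu_{uv}(x_u,x_v)=\mu_v(x_v)$. For $x\in X_A$, $\delta(x)\in\Lambda_A$ is its indicator vector. Energies that are sums of unary and pairwise terms are extended linearly to $\Lambda_A$ (each $f_v$ becomes $\sum_{x_v}f_v(x_v)\mu_v(x_v)$, each $f_{uv}$ becomes $\sum_{x_u,x_v}f_{uv}(x_u,x_v)\mu_{uv}(x_u,x_v)$). A labeling $x\in X_A$ is persistent if it coincides on $A$ with a minimizer of $E_{\mathcal V}$ over $X_{\mathcal V}$. Relaxed criterion: $x\in X_A$ is identifiable by the relaxed criterion if $\delta(x)\in\operatorname{arg\,min}_{\mu\in\Lambda_A}\hat E_{A,x}(\mu)$ (this implies persistency). A labeling $x^\ast\in X_A$ is strongly persistent on $A$ if $x'\in\operatorname{arg\,min}_{x\in X_A}\hat E_{A,x'}(x)$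 implies $x'=x^\ast$, i.e. $x^\ast$ is the unique labeling on $A$ such that $x^\ast\in\operatorname{arg\,min}_{x\in X_A}\hat E_{A,x^\ast}(x)$. Pruning algorithm. Initialize: choose $\mu^0\in\operatorname{arg\,min}_{\mu\in\Lambda_{\mathcal V}}E_{\mathcal V}(\mu)$, set $A^0=\{u\in\mathcal V:\mu^0_u\in\{0,1\}^{|X_u|}\}$, $t=0$. Repeat: (1) let $x^t\in X_{A^t}$ be given by $\mu^t_u(x^t_u)=1$, $u\in A^t$; (2) choose $\mu^{t+1}\in\operatorname{arg\,min}_{\mu\in\Lambda_{A^t}}\hat E_{A^t,x^t}(\mu)$; (3) set $t:=t+1$; (4) $W^t=\{u\in\partial\mathcal V_{A^{t-1}}:\mu^t_u(x^{t-1}_u)\neq1\}$; (5) $A^t=\{u\in A^{t-1}:\mu^t_u\in\{0,1\}^{|X_u|}\}\setminus W^t$; until $A^t=A^{t-1}$. Output $A^\ast=A^t$ and $x^\ast\in X_{A^\ast}$ with $\mu^t_u(x^\ast_u)=1$ for $u\in A^\ast$.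
   Formalization: With ties an arbitrary choice of minimizers can miss A*_strong, so the formal version says some choice yields an A* containing it and all such sets at once; every choice does so if δ(x^0) is the only minimizer over the local polytope on A*_strong. Every output is shown persistent. *)

theory Defs
  imports Complex_Main "HOL-Library.FuncSet"
begin

record ('v, 'l) graphical_model =
  nodes :: "'v set"
  edges :: "'v set set"
  labels :: "'v \<Rightarrow> 'l set"
  unary :: "'v \<Rightarrow> 'l \<Rightarrow> real"
  pairwise :: "'v \<Rightarrow> 'v \<Rightarrow> 'l \<Rightarrow> 'l \<Rightarrow> real"

text \<open>
  An edge is the two-element set of its end points. As \<open>pairwise G\<close> takes the end points in
  either order, symmetry says that both orders give the same number. Label sets must be nonempty
  for the maxima and minima over them to exist.
\<close>

locale wf_graphical_model =
  fixes G :: "('v, 'l) graphical_model"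
  assumes finite_nodes: "finite (nodes G)"
    and edge_ends: "e \<in> edges G \<Longrightarrow> \<exists>u\<in>nodes G. \<exists>v\<in>nodes G. u \<noteq> v \<and> e = {u, v}"
    and finite_labels: "v \<in> nodes G \<Longrightarrow> finite (labels G v)"
    and labels_nonempty: "v \<in> nodes G \<Longrightarrow> labels G v \<noteq> {}"
    and pairwise_sym: "\<lbrakk>{u, v} \<in> edges G; a \<in> labels G u; b \<in> labels G v\<rbrakk>
          \<Longrightarrow> pairwise G u v a b = pairwise G v u b a"

definition labelings :: "('v, 'l) graphical_model \<Rightarrow> 'v set \<Rightarrow> ('v \<Rightarrow> 'l) set" where
  "labelings G A = (\<Pi>\<^sub>E v\<in>A. labels G v)"

text \<open>
  An edge \<open>uv\<close> inside \<open>A\<close> contributes both \<open>(u, v)\<close> and \<open>(v, u)\<close> to \<open>inner_arcs\<close>, so sums over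
  undirected edges are half the sums over \<open>inner_arcs\<close>. A boundary edge contributes exactly one
  pair, whose first component is the end point in \<open>A\<close>.
\<close>

definition inner_arcs :: "('v, 'l) graphical_model \<Rightarrow> 'v set \<Rightarrow> ('v \<times> 'v) set" where
  "inner_arcs G A = {(u, v). {u, v} \<in> edges G \<and> u \<in> A \<and> v \<in> A}"

definition boundary_edges :: "('v, 'l) graphical_model \<Rightarrow> 'v set \<Rightarrow> ('v \<times> 'v) set" where
  "boundary_edges G A = {(u, v). {u, v} \<in> edges G \<and> u \<in> A \<and> v \<in> nodes G - A}"

definition boundary_nodes :: "('v, 'l) graphical_model \<Rightarrow> 'v set \<Rightarrow> 'v set" where
  "boundary_nodes G A = {u \<in> A. \<exists>v\<in>nodes G - A. {u, v} \<in> edges G}"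

definition energy :: "('v, 'l) graphical_model \<Rightarrow> 'v set \<Rightarrow> ('v \<Rightarrow> 'l) \<Rightarrow> real" where
  "energy G A x =
     (\<Sum>u\<in>A. unary G u (x u)) + (\<Sum>(u, v)\<in>inner_arcs G A. pairwise G u v (x u) (x v)) / 2"

definition boundary_potential ::
    "('v, 'l) graphical_model \<Rightarrow> 'v \<Rightarrow> 'v \<Rightarrow> 'l \<Rightarrow> 'l \<Rightarrow> real" where
  "boundary_potential G u v y a =
     (if a = y then Max ((\<lambda>b. pairwise G u v a b) ` labels G v)
      else Min ((\<lambda>b. pairwise G u v a b) ` labels G v))"

definition test_energy ::
    "('v, 'l) graphical_model \<Rightarrow> 'v set \<Rightarrow> ('v \<Rightarrow> 'l) \<Rightarrow> ('v \<Rightarrow> 'l) \<Rightarrow> real" where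
  "test_energy G A y x =
     energy G A x + (\<Sum>(u, v)\<in>boundary_edges G A. boundary_potential G u v (y u) (x u))"

type_synonym ('v, 'l) marginals =
  "('v \<Rightarrow> 'l \<Rightarrow> real) \<times> ('v \<Rightarrow> 'v \<Rightarrow> 'l \<Rightarrow> 'l \<Rightarrow> real)"

abbreviation node_marg :: "('v, 'l) marginals \<Rightarrow> 'v \<Rightarrow> 'l \<Rightarrow> real" where
  "node_marg \<mu> \<equiv> fst \<mu>"

abbreviation edge_marg :: "('v, 'l) marginals \<Rightarrow> 'v \<Rightarrow> 'v \<Rightarrow> 'l \<Rightarrow> 'l \<Rightarrow> real" where
  "edge_marg \<mu> \<equiv> snd \<mu>"

text \<open>
  Entries that are not components of a vector over \<open>A\<close> are fixed to 0, so that equality of pairs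
  is equality of vectors. As for \<open>pairwise\<close>, \<open>edge_marg \<mu> u v a b\<close> and \<open>edge_marg \<mu> v u b a\<close>
  stand for the same component.
\<close>

definition local_polytope ::
    "('v, 'l) graphical_model \<Rightarrow> 'v set \<Rightarrow> ('v, 'l) marginals set" where
  "local_polytope G A = {\<mu>.
     (\<forall>v a. 0 \<le> node_marg \<mu> v a) \<and>
     (\<forall>u v a b. 0 \<le> edge_marg \<mu> u v a b) \<and>
     (\<forall>v a. \<not> (v \<in> A \<and> a \<in> labels G v) \<longrightarrow> node_marg \<mu> v a = 0) \<and>
     (\<forall>u v a b. \<not> ((u, v) \<in> inner_arcs G A \<and> a \<in> labels G u \<and> b \<in> labels G v)
        \<longrightarrow> edge_marg \<mu> u v a b = 0) \<and>
     (\<forall>u v a b. edge_marg \<mu> u v a b = edge_marg \<mu> v u b a) \<and>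
     (\<forall>v\<in>A. (\<Sum>a\<in>labels G v. node_marg \<mu> v a) = 1) \<and>
     (\<forall>(u, v)\<in>inner_arcs G A.
        (\<forall>a\<in>labels G u. (\<Sum>b\<in>labels G v. edge_marg \<mu> u v a b) = node_marg \<mu> u a) \<and>
        (\<forall>b\<in>labels G v. (\<Sum>a\<in>labels G u. edge_marg \<mu> u v a b) = node_marg \<mu> v b))}"

definition indicator_marginals ::
    "('v, 'l) graphical_model \<Rightarrow> 'v set \<Rightarrow> ('v \<Rightarrow> 'l) \<Rightarrow> ('v, 'l) marginals" where
  "indicator_marginals G A x =
     (\<lambda>v a. if v \<in> A \<and> a = x v then 1 else 0,
      \<lambda>u v a b. if (u, v) \<in> inner_arcs G A \<and> a = x u \<and> b = x v then 1 else 0)"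

definition relaxed_energy ::
    "('v, 'l) graphical_model \<Rightarrow> 'v set \<Rightarrow> ('v, 'l) marginals \<Rightarrow> real" where
  "relaxed_energy G A \<mu> =
     (\<Sum>u\<in>A. \<Sum>a\<in>labels G u. unary G u a * node_marg \<mu> u a) +
     (\<Sum>(u, v)\<in>inner_arcs G A.
        \<Sum>a\<in>labels G u. \<Sum>b\<in>labels G v. pairwise G u v a b * edge_marg \<mu> u v a b) / 2"

definition relaxed_test_energy ::
    "('v, 'l) graphical_model \<Rightarrow> 'v set \<Rightarrow> ('v \<Rightarrow> 'l) \<Rightarrow> ('v, 'l) marginals \<Rightarrow> real" where
  "relaxed_test_energy G A y \<mu> =
     relaxed_energy G A \<mu> +
     (\<Sum>(u, v)\<in>boundary_edges G A.
        \<Sum>a\<in>labels G u. boundary_potential G u v (y u) a * node_marg \<mu> u a)"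

definition persistent :: "('v, 'l) graphical_model \<Rightarrow> 'v set \<Rightarrow> ('v \<Rightarrow> 'l) \<Rightarrow> bool" where
  "persistent G A x \<longleftrightarrow> x \<in> labelings G A \<and>
     (\<exists>z. is_arg_min (energy G (nodes G)) (\<lambda>z. z \<in> labelings G (nodes G)) z \<and> (\<forall>v\<in>A. z v = x v))"

definition relaxed_identifiable ::
    "('v, 'l) graphical_model \<Rightarrow> 'v set \<Rightarrow> ('v \<Rightarrow> 'l) \<Rightarrow> bool" where
  "relaxed_identifiable G A x \<longleftrightarrow> x \<in> labelings G A \<and>
     is_arg_min (relaxed_test_energy G A x) (\<lambda>\<mu>. \<mu> \<in> local_polytope G A)
       (indicator_marginals G A x)"

definition strongly_persistent ::
    "('v, 'l) graphical_model \<Rightarrow> 'v set \<Rightarrow> ('v \<Rightarrow> 'l) \<Rightarrow> bool" where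
  "strongly_persistent G A x \<longleftrightarrow>
     is_arg_min (test_energy G A x) (\<lambda>z. z \<in> labelings G A) x \<and>
     (\<forall>x'. is_arg_min (test_energy G A x') (\<lambda>z. z \<in> labelings G A) x' \<longrightarrow> x' = x)"

definition integral_nodes ::
    "('v, 'l) graphical_model \<Rightarrow> 'v set \<Rightarrow> ('v, 'l) marginals \<Rightarrow> 'v set" where
  "integral_nodes G A \<mu> = {u \<in> A. \<forall>a\<in>labels G u. node_marg \<mu> u a \<in> {0, 1}}"

definition integral_labeling ::
    "('v, 'l) graphical_model \<Rightarrow> 'v set \<Rightarrow> ('v, 'l) marginals \<Rightarrow> 'v \<Rightarrow> 'l" where
  "integral_labeling G A \<mu> = (\<lambda>u\<in>A. THE a. a \<in> labels G u \<and> node_marg \<mu> u a = 1)"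

text \<open>
  The pruning algorithm is nondeterministic, since it may take any minimizer of its linear
  programs. A state is the current node set together with the last minimizer.

  The choice matters. Take nodes \<open>u, v\<close> with labels 0, 1, one edge with \<open>\<theta>\<^sub>u\<^sub>v(0, \<cdot>) = (1, 0)\<close> and
  \<open>\<theta>\<^sub>u\<^sub>v(1, \<cdot>) = (0, 1)\<close>, and unaries \<open>\<theta>\<^sub>u = (0, 1)\<close>, \<open>\<theta>\<^sub>v = (0, 100)\<close>. On \<open>{u}\<close> only the label 0 is
  identifiable by the relaxed criterion, and it is strongly persistent. Yet (0, 0) and (1, 0) both
  minimize the full energy, and the execution that starts from their midpoint outputs \<open>{v}\<close>.
\<close>

definition pruning_init ::
    "('v, 'l) graphical_model \<Rightarrow> 'v set \<times> ('v, 'l) marginals \<Rightarrow> bool" where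
  "pruning_init G = (\<lambda>(A, \<mu>).
     is_arg_min (relaxed_energy G (nodes G)) (\<lambda>\<mu>. \<mu> \<in> local_polytope G (nodes G)) \<mu> \<and>
     A = integral_nodes G (nodes G) \<mu>)"

definition pruning_step ::
    "('v, 'l) graphical_model \<Rightarrow> 'v set \<times> ('v, 'l) marginals \<Rightarrow>
     'v set \<times> ('v, 'l) marginals \<Rightarrow> bool" where
  "pruning_step G = (\<lambda>(A, \<mu>) (A', \<mu>').
     let x = integral_labeling G A \<mu>;
         W = {u \<in> boundary_nodes G A. node_marg \<mu>' u (x u) \<noteq> 1}
     in is_arg_min (relaxed_test_energy G A x) (\<lambda>\<mu>. \<mu> \<in> local_polytope G A) \<mu>' \<and>
        A' = integral_nodes G A \<mu>' - W)"

inductive pruning_reachable ::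
    "('v, 'l) graphical_model \<Rightarrow> 'v set \<times> ('v, 'l) marginals \<Rightarrow> bool"
  for G :: "('v, 'l) graphical_model" where
  init: "pruning_init G s \<Longrightarrow> pruning_reachable G s"
| step: "\<lbrakk>pruning_reachable G s; pruning_step G s s'; fst s' \<noteq> fst s\<rbrakk> \<Longrightarrow> pruning_reachable G s'"

definition pruning_output ::
    "('v, 'l) graphical_model \<Rightarrow> 'v set \<Rightarrow> ('v \<Rightarrow> 'l) \<Rightarrow> bool" where
  "pruning_output G A x \<longleftrightarrow>
     (\<exists>\<mu> \<mu>'. pruning_reachable G (A, \<mu>) \<and> pruning_step G (A, \<mu>) (A, \<mu>') \<and>
        x = integral_labeling G A \<mu>')"

text \<open>No execution gets stuck, and none runs forever without meeting the stopping condition.\<close>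

definition pruning_terminates :: "('v, 'l) graphical_model \<Rightarrow> bool" where
  "pruning_terminates G \<longleftrightarrow>
     (\<exists>s. pruning_init G s) \<and>
     (\<forall>s. pruning_reachable G s \<longrightarrow> (\<exists>s'. pruning_step G s s')) \<and>
     \<not> (\<exists>S. pruning_init G (S 0) \<and>
          (\<forall>t::nat. pruning_step G (S t) (S (Suc t)) \<and> fst (S (Suc t)) \<noteq> fst (S t)))"

end

theory Submission
  imports Defs "HOL-Analysis.Function_Topology"
begin

text \<open>
  Suppose \<open>x\<close> is identifiable on \<open>B \<subseteq> A\<close>. Overwriting \<open>\<mu> \<in> \<Lambda>\<^sub>A\<close> on \<open>B\<close> by \<open>\<delta>(x)\<close>, with product
  marginals on the edges between \<open>B\<close> and \<open>A - B\<close>, changes the test energy on \<open>A\<close> by at most the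
  change of the test energy on \<open>B\<close> from \<open>\<mu>\<close> to \<open>\<delta>(x)\<close>, whatever the test labeling on \<open>A\<close>: in \<open>B\<close>
  the boundary edges are charged the worst case. So overwriting maps minimizers to minimizers.

  For \<open>A = V\<close> and integral \<open>\<mu>\<close> this is persistency. Overwriting by two identifiable labelings in
  turn shows that the union of identifiable sets is identifiable, so a largest identifiable set \<open>U\<close>
  exists; the execution that overwrites every minimizer on \<open>U\<close> never prunes a node of \<open>U\<close>. If
  \<open>\<delta>(x)\<close> is the only minimizer on \<open>B\<close>, every minimizer on \<open>A\<close> restricts to it, and no execution
  prunes \<open>B\<close>.
\<close>

section \<open>Minimizers over the local polytope\<close>

lemma is_arg_min_le: "is_arg_min f P x \<Longrightarrow> P y \<Longrightarrow> f x \<le> (f y :: 'a::linorder)"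
  by (auto simp: is_arg_min_linorder)

lemma is_arg_min_transfer:
  "is_arg_min f P x \<Longrightarrow> P y \<Longrightarrow> f y \<le> (f x :: 'a::linorder) \<Longrightarrow> is_arg_min f P y"
  by (auto simp: is_arg_min_linorder intro: order_trans)

text \<open>The node and label types may be infinite, so marginals live in a function space with the
  product topology, where Tychonoff's theorem supplies compactness.\<close>

lemma compact_product_UNIV:
  fixes K :: "'i \<Rightarrow> 'a::topological_space set"
  assumes "\<And>i. compact (K i)"
  shows "compact {f. \<forall>i. f i \<in> K i}"
proof -
  have "compactin (product_topology (\<lambda>i. euclidean) UNIV) (PiE UNIV K)"
    using assms by (simp add: compactin_PiE)
  moreover have "PiE UNIV K = {f. \<forall>i. f i \<in> K i}"
    by (auto simp: PiE_def Pi_def)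
  ultimately show ?thesis
    by (simp add: euclidean_product_topology)
qed

section \<open>Continuity of the energies and closedness of the polytope\<close>

lemma continuous_on_node_marg [continuous_intros]:
  "continuous_on S (\<lambda>\<mu> :: ('v, 'l) marginals. node_marg \<mu> v a)"
  by (rule continuous_on_product_then_coordinatewise[OF continuous_on_product_then_coordinatewise
      [OF continuous_on_fst[OF continuous_on_id]]])

lemma continuous_on_edge_marg [continuous_intros]:
  "continuous_on S (\<lambda>\<mu> :: ('v, 'l) marginals. edge_marg \<mu> u v a b)"
  by (rule continuous_on_product_then_coordinatewise[OF continuous_on_product_then_coordinatewise
      [OF continuous_on_product_then_coordinatewise[OF continuous_on_product_then_coordinatewise
      [OF continuous_on_snd[OF continuous_on_id]]]]])

lemma continuous_on_relaxed_energy [continuous_intros]: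
  "continuous_on S (relaxed_energy G A)"
  unfolding relaxed_energy_def split_def by (intro continuous_intros) auto

lemma continuous_on_relaxed_test_energy [continuous_intros]:
  "continuous_on S (relaxed_test_energy G A y)"
  unfolding relaxed_test_energy_def split_def by (intro continuous_intros)

lemma closed_local_polytope: "closed (local_polytope G A)"
  unfolding local_polytope_def Ball_def split_paired_All prod.case
  by (intro closed_Collect_conj closed_Collect_all closed_Collect_imp closed_Collect_le
      closed_Collect_eq open_Collect_const continuous_intros)

section \<open>The constraints of the local polytope and their consequences\<close>

context
  fixes G :: "('v, 'l) graphical_model" and A :: "'v set" and \<mu> :: "('v, 'l) marginals"
  assumes mu: "\<mu> \<in> local_polytope G A"
begin

lemma node_marg_nonneg: "0 \<le> node_marg \<mu> v a"
  using mu by (simp add: local_polytope_def)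

lemma edge_marg_nonneg: "0 \<le> edge_marg \<mu> u v a b"
  using mu by (simp add: local_polytope_def)

lemma node_marg_eq_0: "\<not> (v \<in> A \<and> a \<in> labels G v) \<Longrightarrow> node_marg \<mu> v a = 0"
  using mu unfolding local_polytope_def by blast

lemma edge_marg_eq_0:
  "\<not> ((u, v) \<in> inner_arcs G A \<and> a \<in> labels G u \<and> b \<in> labels G v) \<Longrightarrow> edge_marg \<mu> u v a b = 0"
  using mu unfolding local_polytope_def by blast

lemma edge_marg_sym: "edge_marg \<mu> u v a b = edge_marg \<mu> v u b a"
  using mu unfolding local_polytope_def by blast

lemma sum_node_marg: "v \<in> A \<Longrightarrow> (\<Sum>a\<in>labels G v. node_marg \<mu> v a) = 1"
  using mu unfolding local_polytope_def by blast

lemma sum_edge_marg_right: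
  "(u, v) \<in> inner_arcs G A \<Longrightarrow> a \<in> labels G u \<Longrightarrow>
    (\<Sum>b\<in>labels G v. edge_marg \<mu> u v a b) = node_marg \<mu> u a"
  using mu unfolding local_polytope_def by blast

lemma sum_edge_marg_left:
  "(u, v) \<in> inner_arcs G A \<Longrightarrow> b \<in> labels G v \<Longrightarrow>
    (\<Sum>a\<in>labels G u. edge_marg \<mu> u v a b) = node_marg \<mu> v b"
  using mu unfolding local_polytope_def by blast

end

lemma local_polytopeI:
  assumes "\<And>v a. 0 \<le> node_marg \<mu> v a" "\<And>u v a b. 0 \<le> edge_marg \<mu> u v a b"
    and "\<And>v a. \<not> (v \<in> A \<and> a \<in> labels G v) \<Longrightarrow> node_marg \<mu> v a = 0"
    and "\<And>u v a b. \<not> ((u, v) \<in> inner_arcs G A \<and> a \<in> labels G u \<and> b \<in> labels G v) \<Longrightarrow>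
      edge_marg \<mu> u v a b = 0"
    and "\<And>u v a b. edge_marg \<mu> u v a b = edge_marg \<mu> v u b a"
    and "\<And>v. v \<in> A \<Longrightarrow> (\<Sum>a\<in>labels G v. node_marg \<mu> v a) = 1"
    and "\<And>u v a. (u, v) \<in> inner_arcs G A \<Longrightarrow> a \<in> labels G u \<Longrightarrow>
      (\<Sum>b\<in>labels G v. edge_marg \<mu> u v a b) = node_marg \<mu> u a"
    and "\<And>u v b. (u, v) \<in> inner_arcs G A \<Longrightarrow> b \<in> labels G v \<Longrightarrow>
      (\<Sum>a\<in>labels G u. edge_marg \<mu> u v a b) = node_marg \<mu> v b"
  shows "\<mu> \<in> local_polytope G A"
  unfolding local_polytope_def mem_Collect_eq
  using assms by auto

lemma inner_arcs_iff [simp]: "(u, v) \<in> inner_arcs G A \<longleftrightarrow> {u, v} \<in> edges G \<and> u \<in> A \<and> v \<in> A"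
  by (simp add: inner_arcs_def)

lemma boundary_edges_iff [simp]:
  "(u, v) \<in> boundary_edges G A \<longleftrightarrow> {u, v} \<in> edges G \<and> u \<in> A \<and> v \<in> nodes G - A"
  by (simp add: boundary_edges_def)

lemma labelings_in_labels: "x \<in> labelings G A \<Longrightarrow> v \<in> A \<Longrightarrow> x v \<in> labels G v"
  by (auto simp: labelings_def)

context wf_graphical_model
begin

lemma node_marg_le_1:
  assumes mu: "\<mu> \<in> local_polytope G A" and A: "A \<subseteq> nodes G"
  shows "node_marg \<mu> v a \<le> 1"
proof (cases "v \<in> A \<and> a \<in> labels G v")
  case True
  then have "node_marg \<mu> v a \<le> (\<Sum>a\<in>labels G v. node_marg \<mu> v a)"
    using A finite_labels node_marg_nonneg[OF mu] by (intro member_le_sum) auto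
  then show ?thesis
    using sum_node_marg[OF mu] True by simp
qed (simp add: node_marg_eq_0[OF mu])

lemma edge_marg_le_node_marg:
  assumes mu: "\<mu> \<in> local_polytope G A" and A: "A \<subseteq> nodes G"
  shows "edge_marg \<mu> u v a b \<le> node_marg \<mu> u a"
proof (cases "(u, v) \<in> inner_arcs G A \<and> a \<in> labels G u \<and> b \<in> labels G v")
  case True
  then have "edge_marg \<mu> u v a b \<le> (\<Sum>b\<in>labels G v. edge_marg \<mu> u v a b)"
    using A finite_labels edge_marg_nonneg[OF mu] by (intro member_le_sum) auto
  then show ?thesis
    using sum_edge_marg_right[OF mu] True by simp
next
  case False
  then show ?thesis
    using edge_marg_eq_0[OF mu False] node_marg_nonneg[OF mu] by simp
qed

lemma compact_local_polytope:
  assumes A: "A \<subseteq> nodes G"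
  shows "compact (local_polytope G A)"
proof -
  \<comment> \<open>\<open>K\<close> is the cube of all pairs of functions with entries in [0, 1].
    Entries that are not components of a vector are 0, so the whole polytope fits into it.\<close>
  define K where "K = {f :: 'v \<Rightarrow> 'l \<Rightarrow> real. \<forall>v. f v \<in> {g. \<forall>a. g a \<in> {0..1}}} \<times>
    {f :: 'v \<Rightarrow> 'v \<Rightarrow> 'l \<Rightarrow> 'l \<Rightarrow> real.
      \<forall>u. f u \<in> {f. \<forall>v. f v \<in> {f. \<forall>a. f a \<in> {g. \<forall>b. g b \<in> {0..1}}}}}"
  have "compact K"
    unfolding K_def by (intro compact_Times compact_product_UNIV compact_Icc)
  moreover have "local_polytope G A \<subseteq> K"
    using node_marg_nonneg edge_marg_nonneg node_marg_le_1[OF _ A]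
      order_trans[OF edge_marg_le_node_marg[OF _ A] node_marg_le_1[OF _ A]]
    by (fastforce simp: K_def mem_Times_iff)
  ultimately show ?thesis
    using closed_local_polytope compact_Int_closed by (metis inf.absorb2)
qed

lemma indicator_in_local_polytope:
  assumes A: "A \<subseteq> nodes G" and x: "x \<in> labelings G A"
  shows "indicator_marginals G A x \<in> local_polytope G A"
proof -
  have *: "x v \<in> labels G v" "finite (labels G v)" if "v \<in> A" for v
    using that A x finite_labels by (auto simp: labelings_in_labels)
  have sym: "(u, v) \<in> inner_arcs G A \<longleftrightarrow> (v, u) \<in> inner_arcs G A" for u v
    by (auto simp: insert_commute)
  show ?thesis
    by (rule local_polytopeI)
      (use * sym in \<open>auto simp: indicator_marginals_def if_distrib intro!: sum.neutral\<close>)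
qed

lemma labelings_nonempty: "A \<subseteq> nodes G \<Longrightarrow> labelings G A \<noteq> {}"
  using labels_nonempty by (auto simp: labelings_def PiE_eq_empty_iff)

text \<open>Stated for any continuous objective, as it serves the relaxed energy of the
  initialization as well as the test energies of the steps.\<close>

lemma ex_arg_min_local_polytope:
  assumes A: "A \<subseteq> nodes G" and f: "continuous_on (local_polytope G A) (f :: _ \<Rightarrow> real)"
  shows "\<exists>\<mu>. is_arg_min f (\<lambda>\<mu>. \<mu> \<in> local_polytope G A) \<mu>"
proof -
  have "local_polytope G A \<noteq> {}"
    using indicator_in_local_polytope[OF A] labelings_nonempty[OF A] by auto
  from continuous_attains_inf[OF compact_local_polytope[OF A] this f] show ?thesis
    by (force simp: is_arg_min_def not_less)
qed

lemma node_marg_eq_0_of_one: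
  assumes mu: "\<mu> \<in> local_polytope G A" and A: "A \<subseteq> nodes G" and v: "v \<in> A"
    and one: "node_marg \<mu> v a = 1" and b: "b \<noteq> a"
  shows "node_marg \<mu> v b = 0"
proof (cases "b \<in> labels G v")
  case True
  have "node_marg \<mu> v a + node_marg \<mu> v b = (\<Sum>c\<in>{a, b}. node_marg \<mu> v c)"
    using b by simp
  also have "\<dots> \<le> (\<Sum>c\<in>labels G v. node_marg \<mu> v c)"
    \<comment> \<open>The value 1 at \<open>a\<close> forces \<open>a\<close> to be a label of
      \<open>v\<close>, since entries outside the label set are 0.\<close>
    using v True A finite_labels one node_marg_nonneg[OF mu] node_marg_eq_0[OF mu, of v a]
    by (intro sum_mono2) auto
  finally show ?thesis
    using one sum_node_marg[OF mu] node_marg_nonneg[OF mu, of v b] v by simp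
qed (simp add: node_marg_eq_0[OF mu])

text \<open>Each edge entry is at most the node entries at both of its ends, so only the entry at
  (\<open>x u\<close>, \<open>x v\<close>) can be nonzero, and marginalization gives it all the
  mass. Later proofs thus need to check node marginals only.\<close>

lemma integral_marginals_eq_indicator:
  assumes mu: "\<mu> \<in> local_polytope G A" and A: "A \<subseteq> nodes G" and x: "x \<in> labelings G A"
    and one: "\<And>v. v \<in> A \<Longrightarrow> node_marg \<mu> v (x v) = 1"
  shows "\<mu> = indicator_marginals G A x"
proof -
  have zero: "node_marg \<mu> v a = 0" if "v \<in> A" "a \<noteq> x v" for v a
    using node_marg_eq_0_of_one[OF mu A _ one] that by blast
  have "node_marg \<mu> v a = (if v \<in> A \<and> a = x v then 1 else 0)" for v a
    using zero one node_marg_eq_0[OF mu] by (cases "v \<in> A") auto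
  moreover have "edge_marg \<mu> u v a b = (if (u, v) \<in> inner_arcs G A \<and> a = x u \<and> b = x v then 1 else 0)"
    for u v a b
  proof (cases "(u, v) \<in> inner_arcs G A")
    case True
    have zero_edge: "edge_marg \<mu> u v a b = 0" if "a \<noteq> x u \<or> b \<noteq> x v" for a b
      using that True zero edge_marg_nonneg[OF mu, of u v a b] edge_marg_sym[OF mu, of u v a b]
        edge_marg_le_node_marg[OF mu A, of u v a b] edge_marg_le_node_marg[OF mu A, of v u b a]
      by fastforce
    have "1 = (\<Sum>b\<in>labels G v. edge_marg \<mu> u v (x u) b)"
      using sum_edge_marg_right[OF mu True] True one x by (simp add: labelings_in_labels)
    also have "\<dots> = (\<Sum>b\<in>labels G v. if b = x v then edge_marg \<mu> u v (x u) (x v) else 0)"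
      by (intro sum.cong) (auto simp: zero_edge)
    also have "\<dots> = edge_marg \<mu> u v (x u) (x v)"
      using True x A finite_labels by (auto simp: labelings_in_labels subset_iff)
    finally show ?thesis
      using True zero_edge by auto
  qed (simp add: edge_marg_eq_0[OF mu] del: inner_arcs_iff)
  ultimately show ?thesis
    by (auto simp: indicator_marginals_def prod_eq_iff fun_eq_iff)
qed


end

section \<open>Overwriting marginals by a labeling\<close>

definition restrict_marginals :: "'v set \<Rightarrow> ('v, 'l) marginals \<Rightarrow> ('v, 'l) marginals" where
  "restrict_marginals B \<mu> =
     (\<lambda>v a. if v \<in> B then node_marg \<mu> v a else 0,
      \<lambda>u v a b. if u \<in> B \<and> v \<in> B then edge_marg \<mu> u v a b else 0)"

definition overwrite_nodes ::
    "'v set \<Rightarrow> ('v \<Rightarrow> 'l) \<Rightarrow> ('v, 'l) marginals \<Rightarrow> 'v \<Rightarrow> 'l \<Rightarrow> real" where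
  "overwrite_nodes B x \<mu> v a = (if v \<in> B then of_bool (a = x v) else node_marg \<mu> v a)"

text \<open>A point mass has exactly one coupling with another distribution, their product. The same
  formula therefore serves the edges inside \<open>B\<close> and those between \<open>B\<close> and
  \<open>A - B\<close>.\<close>

definition overwrite_marginals ::
    "('v, 'l) graphical_model \<Rightarrow> 'v set \<Rightarrow> 'v set \<Rightarrow> ('v \<Rightarrow> 'l) \<Rightarrow>
     ('v, 'l) marginals \<Rightarrow> ('v, 'l) marginals" where
  "overwrite_marginals G A B x \<mu> =
     (overwrite_nodes B x \<mu>,
      \<lambda>u v a b. if (u, v) \<in> inner_arcs G A \<and> (u \<in> B \<or> v \<in> B)
        then overwrite_nodes B x \<mu> u a * overwrite_nodes B x \<mu> v b else edge_marg \<mu> u v a b)"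

definition node_cost :: "('v, 'l) graphical_model \<Rightarrow> ('v, 'l) marginals \<Rightarrow> 'v \<Rightarrow> real" where
  "node_cost G \<mu> u = (\<Sum>a\<in>labels G u. unary G u a * node_marg \<mu> u a)"

definition edge_cost :: "('v, 'l) graphical_model \<Rightarrow> ('v, 'l) marginals \<Rightarrow> 'v \<Rightarrow> 'v \<Rightarrow> real" where
  "edge_cost G \<mu> u v =
     (\<Sum>a\<in>labels G u. \<Sum>b\<in>labels G v. pairwise G u v a b * edge_marg \<mu> u v a b)"

definition boundary_cost ::
    "('v, 'l) graphical_model \<Rightarrow> ('v \<Rightarrow> 'l) \<Rightarrow> ('v, 'l) marginals \<Rightarrow> 'v \<Rightarrow> 'v \<Rightarrow> real" where
  "boundary_cost G y \<mu> u v =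
     (\<Sum>a\<in>labels G u. boundary_potential G u v (y u) a * node_marg \<mu> u a)"

lemma relaxed_test_energy_costs:
  "relaxed_test_energy G A y \<mu> = (\<Sum>u\<in>A. node_cost G \<mu> u) +
     (\<Sum>(u, v)\<in>inner_arcs G A. edge_cost G \<mu> u v) / 2 +
     (\<Sum>(u, v)\<in>boundary_edges G A. boundary_cost G y \<mu> u v)"
  by (simp add: relaxed_test_energy_def relaxed_energy_def node_cost_def edge_cost_def
      boundary_cost_def)

text \<open>No edge leaves the full node set. This lets results about test energies cover the
  initialization of the algorithm.\<close>

lemma relaxed_test_energy_nodes: "relaxed_test_energy G (nodes G) y = relaxed_energy G (nodes G)"
  by (simp add: relaxed_test_energy_def boundary_edges_def fun_eq_iff)

text \<open>When the algorithm stops, the old and the new labeling are known to agree on the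
  boundary; this lemma exchanges one for the other as test labeling.\<close>

lemma relaxed_test_energy_cong:
  assumes "\<And>u. u \<in> boundary_nodes G A \<Longrightarrow> y u = y' u"
  shows "relaxed_test_energy G A y = relaxed_test_energy G A y'"
proof -
  have "(\<Sum>(u, v)\<in>boundary_edges G A. boundary_cost G y \<mu> u v) =
      (\<Sum>(u, v)\<in>boundary_edges G A. boundary_cost G y' \<mu> u v)" for \<mu> :: "('a, 'b) marginals"
  proof (intro sum.cong refl, clarify)
    fix u v assume "(u, v) \<in> boundary_edges G A"
    then have "y u = y' u"
      by (intro assms) (auto simp: boundary_nodes_def)
    then show "boundary_cost G y \<mu> u v = boundary_cost G y' \<mu> u v"
      by (simp add: boundary_cost_def)
  qed
  then show ?thesis
    by (simp add: relaxed_test_energy_costs fun_eq_iff)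
qed

lemma overwrite_nodes_simps [simp]:
  "v \<in> B \<Longrightarrow> overwrite_nodes B x \<mu> v a = of_bool (a = x v)"
  "v \<notin> B \<Longrightarrow> overwrite_nodes B x \<mu> v a = node_marg \<mu> v a"
  by (auto simp: overwrite_nodes_def)

lemma node_marg_overwrite [simp]:
  "node_marg (overwrite_marginals G A B x \<mu>) = overwrite_nodes B x \<mu>"
  by (simp add: overwrite_marginals_def)

lemma sum_mult_of_bool_eq:
  assumes "finite S" "c \<in> S"
  shows "(\<Sum>a\<in>S. f a * of_bool (a = c)) = (f c :: real)"
  using assms by (simp add: of_bool_def if_distrib cong: if_cong)

context wf_graphical_model
begin

lemma finite_inner_arcs: "A \<subseteq> nodes G \<Longrightarrow> finite (inner_arcs G A)"
  by (rule finite_subset[of _ "nodes G \<times> nodes G"]) (auto simp: finite_nodes)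

lemma finite_boundary_edges: "A \<subseteq> nodes G \<Longrightarrow> finite (boundary_edges G A)"
  by (rule finite_subset[of _ "nodes G \<times> nodes G"]) (auto simp: finite_nodes)

lemma restrict_in_local_polytope:
  assumes mu: "\<mu> \<in> local_polytope G A" and B: "B \<subseteq> A"
  shows "restrict_marginals B \<mu> \<in> local_polytope G B"
  using B node_marg_nonneg[OF mu] edge_marg_nonneg[OF mu] node_marg_eq_0[OF mu]
    edge_marg_eq_0[OF mu] edge_marg_sym[OF mu] sum_node_marg[OF mu]
    sum_edge_marg_right[OF mu] sum_edge_marg_left[OF mu]
  by (intro local_polytopeI) (auto simp: restrict_marginals_def subset_iff)

text \<open>Summing a product over one end leaves the other factor times the total mass 1, so the
  marginalization constraints survive on every edge that meets \<open>B\<close>.\<close>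

lemma overwrite_in_local_polytope:
  assumes mu: "\<mu> \<in> local_polytope G A" and A: "A \<subseteq> nodes G" and B: "B \<subseteq> A"
    and x: "x \<in> labelings G B"
  shows "overwrite_marginals G A B x \<mu> \<in> local_polytope G A"
proof -
  let ?n = "overwrite_nodes B x \<mu>"
  have nonneg: "0 \<le> ?n v a" for v a
    using node_marg_nonneg[OF mu] by (simp add: overwrite_nodes_def)
  have zero: "?n v a = 0" if "\<not> (v \<in> A \<and> a \<in> labels G v)" for v a
    using that node_marg_eq_0[OF mu] B x by (auto simp: overwrite_nodes_def labelings_in_labels)
  have one: "(\<Sum>a\<in>labels G v. ?n v a) = 1" if "v \<in> A" for v
  proof (cases "v \<in> B")
    case True
    then have "finite (labels G v)" "x v \<in> labels G v"
      using A that finite_labels x by (auto simp: labelings_in_labels)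
    from sum_mult_of_bool_eq[OF this, of "\<lambda>_. 1"] True show ?thesis
      by simp
  qed (simp add: sum_node_marg[OF mu that])
  have sym: "(u, v) \<in> inner_arcs G A \<longleftrightarrow> (v, u) \<in> inner_arcs G A" for u v
    by (auto simp: insert_commute)
  let ?e = "\<lambda>u v a b. if (u, v) \<in> inner_arcs G A \<and> (u \<in> B \<or> v \<in> B)
        then ?n u a * ?n v b else edge_marg \<mu> u v a b"
  have right: "(\<Sum>b\<in>labels G v. ?e u v a b) = ?n u a"
    if "(u, v) \<in> inner_arcs G A" "a \<in> labels G u" for u v a
    using that one[of v] sum_edge_marg_right[OF mu that]
    by (cases "u \<in> B \<or> v \<in> B") (auto simp flip: sum_distrib_left)
  have left: "(\<Sum>a\<in>labels G u. ?e u v a b) = ?n v b"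
    if "(u, v) \<in> inner_arcs G A" "b \<in> labels G v" for u v b
    using that one[of u] sum_edge_marg_left[OF mu that]
    by (cases "u \<in> B \<or> v \<in> B") (auto simp flip: sum_distrib_right)
  have esym: "?e u v a b = ?e v u b a" for u v a b
    using sym[of u v] edge_marg_sym[OF mu] by (auto simp del: inner_arcs_iff)
  have ezero: "?e u v a b = 0"
    if "\<not> ((u, v) \<in> inner_arcs G A \<and> a \<in> labels G u \<and> b \<in> labels G v)" for u v a b
    using that zero edge_marg_eq_0[OF mu that] by (auto simp del: inner_arcs_iff)
  have enonneg: "0 \<le> ?e u v a b" for u v a b
    using nonneg edge_marg_nonneg[OF mu] by simp
  show ?thesis
    by (rule local_polytopeI; unfold overwrite_marginals_def fst_conv snd_conv)
      (fact nonneg zero one right left esym ezero enonneg)+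
qed

text \<open>An edge between \<open>B\<close> and \<open>A - B\<close> occurs in
  \<open>inner_arcs G A\<close> in both orientations. By symmetry both contribute the same, so after
  halving it counts once, oriented out of \<open>B\<close>.\<close>

lemma sum_inner_arcs_split:
  fixes p :: "'v \<Rightarrow> 'v \<Rightarrow> real"
  assumes A: "A \<subseteq> nodes G" and B: "B \<subseteq> A"
    and sym: "\<And>u v. (u, v) \<in> inner_arcs G A \<Longrightarrow> p u v = p v u"
  shows "(\<Sum>(u, v)\<in>inner_arcs G A. p u v) / 2 =
    (\<Sum>(u, v)\<in>inner_arcs G B. p u v) / 2 + (\<Sum>(u, v)\<in>{e \<in> boundary_edges G B. snd e \<in> A}. p u v) +
    (\<Sum>(u, v)\<in>inner_arcs G (A - B). p u v) / 2"
proof -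
  let ?C = "{e \<in> boundary_edges G B. snd e \<in> A}"
  have fin: "finite (inner_arcs G B)" "finite ?C" "finite (inner_arcs G (A - B))"
    using A B finite_inner_arcs[of B] finite_inner_arcs[of "A - B"] finite_boundary_edges[of B] by auto
  have eq: "inner_arcs G A = (inner_arcs G B \<union> inner_arcs G (A - B)) \<union> (?C \<union> prod.swap ` ?C)"
    using A B by (auto simp: image_iff insert_commute)
  have "(\<Sum>(u, v)\<in>prod.swap ` ?C. p u v) = (\<Sum>(u, v)\<in>?C. p v u)"
    by (subst sum.reindex) (auto simp: inj_on_def case_prod_unfold)
  also have "\<dots> = (\<Sum>(u, v)\<in>?C. p u v)"
    using B by (intro sum.cong) (auto intro!: sym simp: insert_commute)
  finally have swap: "(\<Sum>(u, v)\<in>prod.swap ` ?C. p u v) = (\<Sum>(u, v)\<in>?C. p u v)" .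
  have "(\<Sum>(u, v)\<in>inner_arcs G A. p u v) =
      (\<Sum>(u, v)\<in>inner_arcs G B. p u v) + (\<Sum>(u, v)\<in>inner_arcs G (A - B). p u v) +
      ((\<Sum>(u, v)\<in>?C. p u v) + (\<Sum>(u, v)\<in>prod.swap ` ?C. p u v))"
    unfolding eq using fin
    by (subst sum.union_disjoint, simp, simp, force)
      (subst sum.union_disjoint, simp, simp, force, subst sum.union_disjoint, simp, simp, force, simp)
  then show ?thesis
    using swap by (simp add: field_simps)
qed

text \<open>A boundary edge of \<open>B\<close> either ends in \<open>A\<close> (\<open>?C\<close>)
  or leaves \<open>A\<close> as well (\<open>?D\<close>). The set \<open>?D\<close> consists of the
  boundary edges of \<open>A\<close> that start in \<open>B\<close>.\<close>

lemma sum_boundary_edges_split: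
  fixes p q :: "'v \<Rightarrow> 'v \<Rightarrow> real"
  assumes A: "A \<subseteq> nodes G" and B: "B \<subseteq> A"
  shows "(\<Sum>(u, v)\<in>{e \<in> boundary_edges G B. snd e \<in> A}. p u v) + (\<Sum>(u, v)\<in>boundary_edges G A. q u v) =
    (\<Sum>(u, v)\<in>boundary_edges G B. if v \<in> A then p u v else q u v) +
    (\<Sum>(u, v)\<in>{e \<in> boundary_edges G A. fst e \<notin> B}. q u v)"
proof -
  let ?C = "{e \<in> boundary_edges G B. snd e \<in> A}"
  let ?D = "{e \<in> boundary_edges G A. fst e \<in> B}"
  have fin: "finite (boundary_edges G B)" "finite (boundary_edges G A)"
    using A B finite_boundary_edges by auto
  have eq: "boundary_edges G B = ?C \<union> ?D" and disj: "?C \<inter> ?D = {}"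
    using A B by auto
  have "(\<Sum>(u, v)\<in>boundary_edges G B. if v \<in> A then p u v else q u v) =
      (\<Sum>(u, v)\<in>?C. if v \<in> A then p u v else q u v) + (\<Sum>(u, v)\<in>?D. if v \<in> A then p u v else q u v)"
    using fin by (subst eq, intro sum.union_disjoint disj) auto
  also have "(\<Sum>(u, v)\<in>?C. if v \<in> A then p u v else q u v) = (\<Sum>(u, v)\<in>?C. p u v)"
    by (intro sum.cong) auto
  also have "(\<Sum>(u, v)\<in>?D. if v \<in> A then p u v else q u v) = (\<Sum>(u, v)\<in>?D. q u v)"
    by (intro sum.cong) auto
  finally have 1: "(\<Sum>(u, v)\<in>boundary_edges G B. if v \<in> A then p u v else q u v) =
      (\<Sum>(u, v)\<in>?C. p u v) + (\<Sum>(u, v)\<in>?D. q u v)" .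
  have "(\<Sum>(u, v)\<in>boundary_edges G A. q u v) =
      (\<Sum>(u, v)\<in>?D. q u v) + (\<Sum>(u, v)\<in>boundary_edges G A - ?D. q u v)"
    using fin by (subst sum.subset_diff[of ?D]) auto
  moreover have "boundary_edges G A - ?D = {e \<in> boundary_edges G A. fst e \<notin> B}"
    by auto
  ultimately show ?thesis
    using 1 by simp
qed

text \<open>Separates what overwriting on \<open>B\<close> does: it leaves the last bracket alone,
  fixes the node and inner edge costs of \<open>B\<close> to those of the labeling, and changes the
  edges leaving \<open>B\<close> in a way that needs an estimate.\<close>

lemma relaxed_test_energy_split:
  assumes A: "A \<subseteq> nodes G" and B: "B \<subseteq> A" and mu: "\<mu> \<in> local_polytope G A"
  shows "relaxed_test_energy G A y \<mu> =
    (\<Sum>u\<in>B. node_cost G \<mu> u) + (\<Sum>(u, v)\<in>inner_arcs G B. edge_cost G \<mu> u v) / 2 +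
    (\<Sum>(u, v)\<in>boundary_edges G B. if v \<in> A then edge_cost G \<mu> u v else boundary_cost G y \<mu> u v) +
    ((\<Sum>u\<in>A - B. node_cost G \<mu> u) + (\<Sum>(u, v)\<in>inner_arcs G (A - B). edge_cost G \<mu> u v) / 2 +
     (\<Sum>(u, v)\<in>{e \<in> boundary_edges G A. fst e \<notin> B}. boundary_cost G y \<mu> u v))"
proof -
  have "edge_cost G \<mu> u v = edge_cost G \<mu> v u" if "(u, v) \<in> inner_arcs G A" for u v
  proof -
    have "edge_cost G \<mu> u v =
        (\<Sum>a\<in>labels G u. \<Sum>b\<in>labels G v. pairwise G v u b a * edge_marg \<mu> v u b a)"
      unfolding edge_cost_def using that pairwise_sym edge_marg_sym[OF mu, of u v]
      by (intro sum.cong refl) auto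
    then show ?thesis
      unfolding edge_cost_def by (subst sum.swap) simp
  qed
  note sum_inner_arcs_split[OF A B, of "edge_cost G \<mu>", OF this]
  moreover have "(\<Sum>u\<in>A. node_cost G \<mu> u) = (\<Sum>u\<in>A - B. node_cost G \<mu> u) + (\<Sum>u\<in>B. node_cost G \<mu> u)"
    using A B finite_subset[OF A finite_nodes] by (intro sum.subset_diff)
  moreover note sum_boundary_edges_split[OF A B, of "edge_cost G \<mu>" "boundary_cost G y \<mu>"]
  ultimately show ?thesis
    unfolding relaxed_test_energy_costs by linarith
qed

text \<open>With test label \<open>c\<close>, the right-hand side is the maximum at \<open>c\<close>
  minus the minimum at \<open>a\<close>, the largest difference that values between the minima and
  the maxima can have.\<close>

lemma boundary_potential_le:
  assumes "u \<in> nodes G" "v \<in> nodes G" "b \<in> labels G v" "a \<noteq> c"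
  shows "pairwise G u v c b - pairwise G u v a b \<le>
      boundary_potential G u v c c - boundary_potential G u v c a" (is ?le)
    and "boundary_potential G u v d c - boundary_potential G u v d a \<le>
      boundary_potential G u v c c - boundary_potential G u v c a" (is ?le')
proof -
  let ?p = "\<lambda>a. pairwise G u v a ` labels G v"
  have fin: "finite (?p e)" for e
    using assms finite_labels by simp
  have bounds: "Min (?p e) \<le> pairwise G u v e b" "pairwise G u v e b \<le> Max (?p e)" for e
    using fin assms by auto
  show ?le
    using bounds[of c] bounds[of a] assms by (simp add: boundary_potential_def)
  \<comment> \<open>Chaining the two bounds through the label \<open>b\<close> shows that each
    minimum is at most the corresponding maximum.\<close>
  show ?le'
    using order_trans[OF bounds, of c] order_trans[OF bounds, of a] assms
    by (auto simp: boundary_potential_def)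
qed

text \<open>The new cost is a single value, which may be averaged against \<mu> at \<open>u\<close>
  because these weights sum to 1. Old and new cost then share their weights.\<close>

lemma overwrite_boundary_cost:
  assumes A: "A \<subseteq> nodes G" and B: "B \<subseteq> A" and mu: "\<mu> \<in> local_polytope G A"
    and x: "x \<in> labelings G B" and u: "u \<in> B"
  shows "boundary_cost G y (overwrite_marginals G A B x \<mu>) u v - boundary_cost G y \<mu> u v =
    (\<Sum>a\<in>labels G u. (boundary_potential G u v (y u) (x u) - boundary_potential G u v (y u) a) *
      node_marg \<mu> u a)"
proof -
  have "boundary_cost G y (overwrite_marginals G A B x \<mu>) u v = boundary_potential G u v (y u) (x u)"
    unfolding boundary_cost_def using u A B x finite_labels
    by (simp add: sum_mult_of_bool_eq labelings_in_labels subset_iff)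
  also have "\<dots> = (\<Sum>a\<in>labels G u. boundary_potential G u v (y u) (x u) * node_marg \<mu> u a)"
    using u B sum_node_marg[OF mu, of u] by (auto simp flip: sum_distrib_left)
  finally show ?thesis
    by (simp add: boundary_cost_def left_diff_distrib sum_subtractf)
qed

text \<open>The new cost averages over the marginal of \<mu> at \<open>v\<close>. Writing that
  marginal as a sum of edge marginals puts old and new cost on the same weights.\<close>

lemma overwrite_edge_cost:
  assumes A: "A \<subseteq> nodes G" and B: "B \<subseteq> A" and mu: "\<mu> \<in> local_polytope G A"
    and x: "x \<in> labelings G B" and uv: "{u, v} \<in> edges G" "u \<in> B" "v \<in> A - B"
  shows "edge_cost G (overwrite_marginals G A B x \<mu>) u v - edge_cost G \<mu> u v =
    (\<Sum>a\<in>labels G u. \<Sum>b\<in>labels G v. (pairwise G u v (x u) b - pairwise G u v a b) *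
      edge_marg \<mu> u v a b)"
proof -
  have u: "x u \<in> labels G u" "finite (labels G u)"
    using uv A B x finite_labels by (auto simp: labelings_in_labels)
  have arc: "(u, v) \<in> inner_arcs G A"
    using uv B by auto
  have "edge_cost G (overwrite_marginals G A B x \<mu>) u v =
      (\<Sum>a\<in>labels G u. (\<Sum>b\<in>labels G v. pairwise G u v a b * node_marg \<mu> v b) * of_bool (a = x u))"
    using uv arc by (auto simp: edge_cost_def overwrite_marginals_def sum_distrib_right ac_simps
        intro!: sum.cong)
  also have "\<dots> = (\<Sum>b\<in>labels G v. pairwise G u v (x u) b * node_marg \<mu> v b)"
    using u by (simp add: sum_mult_of_bool_eq)
  also have "\<dots> = (\<Sum>b\<in>labels G v. \<Sum>a\<in>labels G u. pairwise G u v (x u) b * edge_marg \<mu> u v a b)"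
    using sum_edge_marg_left[OF mu arc] by (simp flip: sum_distrib_left)
  also have "\<dots> = (\<Sum>a\<in>labels G u. \<Sum>b\<in>labels G v. pairwise G u v (x u) b * edge_marg \<mu> u v a b)"
    by (rule sum.swap)
  finally show ?thesis
    by (simp add: edge_cost_def left_diff_distrib sum_subtractf)
qed

text \<open>Both changes are averages with the same nonnegative weights, so it suffices to compare
  them label by label: for \<open>a = x u\<close> both differences vanish, and otherwise
  \<open>boundary_potential_le\<close> applies. If \<open>v\<close> lies in \<open>A\<close>, the
  weights are edge marginals, which sum to the node marginal at \<open>u\<close>.\<close>

lemma overwrite_crossing_cost_le:
  assumes A: "A \<subseteq> nodes G" and B: "B \<subseteq> A" and mu: "\<mu> \<in> local_polytope G A"
    and x: "x \<in> labelings G B" and uv: "(u, v) \<in> boundary_edges G B"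
  shows "(if v \<in> A then edge_cost G (overwrite_marginals G A B x \<mu>) u v
        else boundary_cost G y (overwrite_marginals G A B x \<mu>) u v) -
      (if v \<in> A then edge_cost G \<mu> u v else boundary_cost G y \<mu> u v) \<le>
    boundary_cost G x (overwrite_marginals G A B x \<mu>) u v - boundary_cost G x \<mu> u v"
proof -
  let ?h = "boundary_potential G u v"
  have u: "u \<in> B" "u \<in> nodes G" and v: "v \<in> nodes G" "v \<notin> B"
    using uv A B by auto
  have rhs: "boundary_cost G x (overwrite_marginals G A B x \<mu>) u v - boundary_cost G x \<mu> u v =
      (\<Sum>a\<in>labels G u. (?h (x u) (x u) - ?h (x u) a) * node_marg \<mu> u a)"
    by (rule overwrite_boundary_cost[OF A B mu x u(1)])
  show ?thesis
  proof (cases "v \<in> A")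
    case True
    then have arc: "(u, v) \<in> inner_arcs G A"
      using uv B by auto
    have "(\<Sum>a\<in>labels G u. \<Sum>b\<in>labels G v. (pairwise G u v (x u) b - pairwise G u v a b) *
        edge_marg \<mu> u v a b) \<le>
      (\<Sum>a\<in>labels G u. \<Sum>b\<in>labels G v. (?h (x u) (x u) - ?h (x u) a) * edge_marg \<mu> u v a b)"
    proof (intro sum_mono mult_right_mono edge_marg_nonneg[OF mu])
      fix a b assume "a \<in> labels G u" "b \<in> labels G v"
      then show "pairwise G u v (x u) b - pairwise G u v a b \<le> ?h (x u) (x u) - ?h (x u) a"
        using boundary_potential_le(1)[OF u(2) v(1)] by (cases "a = x u") auto
    qed
    also have "\<dots> = (\<Sum>a\<in>labels G u. (?h (x u) (x u) - ?h (x u) a) * node_marg \<mu> u a)"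
      using sum_edge_marg_right[OF mu arc] by (simp flip: sum_distrib_left)
    finally show ?thesis
      using True uv v rhs overwrite_edge_cost[OF A B mu x, of u v] by simp
  next
    case False
    have "(\<Sum>a\<in>labels G u. (?h (y u) (x u) - ?h (y u) a) * node_marg \<mu> u a) \<le>
      (\<Sum>a\<in>labels G u. (?h (x u) (x u) - ?h (x u) a) * node_marg \<mu> u a)"
    proof (intro sum_mono mult_right_mono node_marg_nonneg[OF mu])
      fix a
      obtain b where "b \<in> labels G v"
        using labels_nonempty v by blast
      then show "?h (y u) (x u) - ?h (y u) a \<le> ?h (x u) (x u) - ?h (x u) a"
        using boundary_potential_le(2)[OF u(2) v(1)] by (cases "a = x u") auto
    qed
    then show ?thesis
      using False rhs overwrite_boundary_cost[OF A B mu x u(1), of y v] by simp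
  qed
qed

text \<open>
  The test label \<open>y\<close> on the boundary of \<open>A\<close> is arbitrary: of all test labels, \<open>x\<close> penalizes the
  change to \<open>x\<close> the most.
\<close>

lemma overwrite_energy_le:
  assumes A: "A \<subseteq> nodes G" and B: "B \<subseteq> A" and mu: "\<mu> \<in> local_polytope G A"
    and x: "x \<in> labelings G B"
  shows "relaxed_test_energy G A y (overwrite_marginals G A B x \<mu>) - relaxed_test_energy G A y \<mu> \<le>
    relaxed_test_energy G B x (indicator_marginals G B x) -
    relaxed_test_energy G B x (restrict_marginals B \<mu>)"
proof -
  let ?o = "overwrite_marginals G A B x \<mu>" and ?i = "indicator_marginals G B x"
    and ?r = "restrict_marginals B \<mu>"
  have "(\<Sum>u\<in>A - B. node_cost G ?o u) = (\<Sum>u\<in>A - B. node_cost G \<mu> u)"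
    by (intro sum.cong) (auto simp: node_cost_def)
  moreover have "(\<Sum>(u, v)\<in>inner_arcs G (A - B). edge_cost G ?o u v) =
      (\<Sum>(u, v)\<in>inner_arcs G (A - B). edge_cost G \<mu> u v)"
    by (intro sum.cong) (auto simp: edge_cost_def overwrite_marginals_def)
  moreover have "(\<Sum>(u, v)\<in>{e \<in> boundary_edges G A. fst e \<notin> B}. boundary_cost G y ?o u v) =
      (\<Sum>(u, v)\<in>{e \<in> boundary_edges G A. fst e \<notin> B}. boundary_cost G y \<mu> u v)"
    by (intro sum.cong) (auto simp: boundary_cost_def)
  moreover have "(\<Sum>u\<in>B. node_cost G ?o u) = (\<Sum>u\<in>B. node_cost G ?i u)"
    by (intro sum.cong) (auto simp: node_cost_def indicator_marginals_def of_bool_def)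
  moreover have "(\<Sum>(u, v)\<in>inner_arcs G B. edge_cost G ?o u v) =
      (\<Sum>(u, v)\<in>inner_arcs G B. edge_cost G ?i u v)"
    using B by (intro sum.cong) (auto simp: edge_cost_def indicator_marginals_def
        overwrite_marginals_def intro!: sum.cong)
  moreover have "(\<Sum>(u, v)\<in>boundary_edges G B. boundary_cost G x ?o u v) =
      (\<Sum>(u, v)\<in>boundary_edges G B. boundary_cost G x ?i u v)"
    by (intro sum.cong) (auto simp: boundary_cost_def indicator_marginals_def of_bool_def)
  moreover have "(\<Sum>u\<in>B. node_cost G \<mu> u) = (\<Sum>u\<in>B. node_cost G ?r u)"
    by (intro sum.cong) (auto simp: node_cost_def restrict_marginals_def)
  moreover have "(\<Sum>(u, v)\<in>inner_arcs G B. edge_cost G \<mu> u v) =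
      (\<Sum>(u, v)\<in>inner_arcs G B. edge_cost G ?r u v)"
    by (intro sum.cong) (auto simp: edge_cost_def restrict_marginals_def)
  moreover have "(\<Sum>(u, v)\<in>boundary_edges G B. boundary_cost G x \<mu> u v) =
      (\<Sum>(u, v)\<in>boundary_edges G B. boundary_cost G x ?r u v)"
    by (intro sum.cong) (auto simp: boundary_cost_def restrict_marginals_def)
  \<comment> \<open>This is the only inequality; all other terms of the two splittings cancel or
    match exactly.\<close>
  moreover have "(\<Sum>(u, v)\<in>boundary_edges G B. if v \<in> A then edge_cost G ?o u v else boundary_cost G y ?o u v) -
      (\<Sum>(u, v)\<in>boundary_edges G B. if v \<in> A then edge_cost G \<mu> u v else boundary_cost G y \<mu> u v) \<le>
      (\<Sum>(u, v)\<in>boundary_edges G B. boundary_cost G x ?o u v) -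
      (\<Sum>(u, v)\<in>boundary_edges G B. boundary_cost G x \<mu> u v)"
    unfolding sum_subtractf[symmetric] case_prod_unfold
    by (intro sum_mono overwrite_crossing_cost_le[OF A B mu x]) simp
  ultimately show ?thesis
    unfolding relaxed_test_energy_split[OF A B mu] relaxed_test_energy_costs[of G B]
      relaxed_test_energy_split[OF A B overwrite_in_local_polytope[OF mu A B x]]
    by linarith
qed

section \<open>Identifiable labelings\<close>

lemma overwrite_identifiable_le:
  assumes "A \<subseteq> nodes G" "B \<subseteq> A" "\<mu> \<in> local_polytope G A" "relaxed_identifiable G B x"
  shows "relaxed_test_energy G A y (overwrite_marginals G A B x \<mu>) \<le> relaxed_test_energy G A y \<mu>"
proof -
  have "relaxed_test_energy G B x (indicator_marginals G B x) \<le>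
      relaxed_test_energy G B x (restrict_marginals B \<mu>)"
    using assms(4) is_arg_min_le restrict_in_local_polytope[OF assms(3,2)]
    by (fastforce simp: relaxed_identifiable_def)
  then show ?thesis
    using overwrite_energy_le[OF assms(1-3), of x y] assms(4) by (simp add: relaxed_identifiable_def)
qed

lemma arg_min_overwrite:
  assumes A: "A \<subseteq> nodes G" and B: "B \<subseteq> A" and id: "relaxed_identifiable G B x"
    and min: "is_arg_min (relaxed_test_energy G A y) (\<lambda>\<mu>. \<mu> \<in> local_polytope G A) \<mu>"
  shows "is_arg_min (relaxed_test_energy G A y) (\<lambda>\<mu>. \<mu> \<in> local_polytope G A)
    (overwrite_marginals G A B x \<mu>)"
proof -
  have mu: "\<mu> \<in> local_polytope G A"
    using min by (simp add: is_arg_min_def)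
  have "overwrite_marginals G A B x \<mu> \<in> local_polytope G A"
    using overwrite_in_local_polytope[OF mu A B] id by (simp add: relaxed_identifiable_def)
  then show ?thesis
    by (rule is_arg_min_transfer[OF min _ overwrite_identifiable_le[OF A B mu id]])
qed

text \<open>The estimate read backwards: overwriting cannot lower the energy of a minimizer on
  \<open>A\<close>, so its restriction cannot cost more on \<open>B\<close> than
  \<delta>(x).\<close>

lemma arg_min_restrict:
  assumes A: "A \<subseteq> nodes G" and B: "B \<subseteq> A" and id: "relaxed_identifiable G B x"
    and min: "is_arg_min (relaxed_test_energy G A y) (\<lambda>\<mu>. \<mu> \<in> local_polytope G A) \<mu>"
  shows "is_arg_min (relaxed_test_energy G B x) (\<lambda>\<mu>. \<mu> \<in> local_polytope G B)
    (restrict_marginals B \<mu>)"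
proof -
  have mu: "\<mu> \<in> local_polytope G A" and x: "x \<in> labelings G B"
    using min id by (simp_all add: is_arg_min_def relaxed_identifiable_def)
  have "relaxed_test_energy G A y \<mu> \<le> relaxed_test_energy G A y (overwrite_marginals G A B x \<mu>)"
    by (rule is_arg_min_le[OF min overwrite_in_local_polytope[OF mu A B x]])
  then have "relaxed_test_energy G B x (restrict_marginals B \<mu>) \<le>
      relaxed_test_energy G B x (indicator_marginals G B x)"
    using overwrite_energy_le[OF A B mu x, of y] by linarith
  moreover have "is_arg_min (relaxed_test_energy G B x) (\<lambda>\<mu>. \<mu> \<in> local_polytope G B)
      (indicator_marginals G B x)"
    using id by (simp add: relaxed_identifiable_def)
  ultimately show ?thesis
    using restrict_in_local_polytope[OF mu B] by (rule is_arg_min_transfer[rotated 2])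
qed

section \<open>Persistency and unions of identifiable labelings\<close>

lemma relaxed_energy_indicator:
  assumes "A \<subseteq> nodes G" "x \<in> labelings G A"
  shows "relaxed_energy G A (indicator_marginals G A x) = energy G A x"
proof -
  have *: "x v \<in> labels G v" "finite (labels G v)" if "v \<in> A" for v
    using that assms finite_labels by (auto simp: labelings_in_labels)
  have "(\<Sum>a\<in>labels G u. unary G u a * node_marg (indicator_marginals G A x) u a) =
      unary G u (x u)" if "u \<in> A" for u
    using that sum_mult_of_bool_eq[of "labels G u" "x u" "unary G u"] *
    by (simp add: indicator_marginals_def of_bool_def)
  moreover have "edge_cost G (indicator_marginals G A x) u v = pairwise G u v (x u) (x v)"
    if "(u, v) \<in> inner_arcs G A" for u v
  proof -
    have "edge_cost G (indicator_marginals G A x) u v = (\<Sum>a\<in>labels G u.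
        (\<Sum>b\<in>labels G v. pairwise G u v a b * of_bool (b = x v)) * of_bool (a = x u))"
      unfolding edge_cost_def sum_distrib_right using that
      by (intro sum.cong refl) (auto simp: indicator_marginals_def)
    then show ?thesis
      using that * by (simp add: sum_mult_of_bool_eq)
  qed
  then have "(\<Sum>(u, v)\<in>inner_arcs G A. edge_cost G (indicator_marginals G A x) u v) =
      (\<Sum>(u, v)\<in>inner_arcs G A. pairwise G u v (x u) (x v))"
    by (intro sum.cong) auto
  ultimately show ?thesis
    by (simp add: relaxed_energy_def energy_def edge_cost_def)
qed

lemma relaxed_identifiable_imp_persistent:
  assumes A: "A \<subseteq> nodes G" and id: "relaxed_identifiable G A x"
  shows "persistent G A x"
proof -
  have x: "x \<in> labelings G A"
    using id by (simp add: relaxed_identifiable_def)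
  have "finite (labelings G (nodes G))"
    unfolding labelings_def using finite_nodes finite_labels by (intro finite_PiE)
  from ex_is_arg_min_if_finite[OF this labelings_nonempty[OF order_refl], of "energy G (nodes G)"]
  obtain z where z: "is_arg_min (energy G (nodes G)) (\<lambda>z. z \<in> labelings G (nodes G)) z" ..
  then have zl: "z \<in> labelings G (nodes G)"
    by (simp add: is_arg_min_def)
  \<comment> \<open>A global minimizer with \<open>x\<close> pasted in on \<open>A\<close>; the goal
    is that pasting does not raise the energy.\<close>
  define w where "w v = (if v \<in> A then x v else z v)" for v
  have w: "w \<in> labelings G (nodes G)"
    using x zl A by (auto simp: labelings_def w_def PiE_iff extensional_def)
  let ?z = "indicator_marginals G (nodes G) z" and ?w = "indicator_marginals G (nodes G) w"
  have zp: "?z \<in> local_polytope G (nodes G)"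
    by (rule indicator_in_local_polytope[OF order_refl zl])
  \<comment> \<open>Overwriting an integral vector gives an integral vector, so the relaxed estimate
    becomes one between energies of labelings.\<close>
  have "overwrite_marginals G (nodes G) A x ?z = ?w"
    by (rule integral_marginals_eq_indicator[OF overwrite_in_local_polytope[OF zp order_refl A x]
          order_refl w]) (auto simp: w_def overwrite_nodes_def indicator_marginals_def)
  then have "energy G (nodes G) w \<le> energy G (nodes G) z"
    using overwrite_identifiable_le[OF order_refl A zp id] w zl
    by (simp add: relaxed_test_energy_nodes relaxed_energy_indicator)
  then have "is_arg_min (energy G (nodes G)) (\<lambda>z. z \<in> labelings G (nodes G)) w"
    using is_arg_min_transfer[OF z, of w] w by simp
  then show ?thesis
    using x by (auto simp: persistent_def w_def)
qed

lemma relaxed_identifiable_Un: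
  assumes B: "B \<subseteq> nodes G" "relaxed_identifiable G B x"
    and C: "C \<subseteq> nodes G" "relaxed_identifiable G C x'"
  shows "relaxed_identifiable G (B \<union> C) (\<lambda>v. if v \<in> C then x' v else x v)"
proof -
  let ?A = "B \<union> C" and ?w = "\<lambda>v. if v \<in> C then x' v else x v"
  have A: "?A \<subseteq> nodes G" "B \<subseteq> ?A" "C \<subseteq> ?A"
    using B C by auto
  have x: "x \<in> labelings G B" "x' \<in> labelings G C"
    using B C by (auto simp: relaxed_identifiable_def)
  then have w: "?w \<in> labelings G ?A"
    by (auto simp: labelings_def PiE_iff extensional_def)
  have "relaxed_test_energy G ?A ?w (indicator_marginals G ?A ?w) \<le> relaxed_test_energy G ?A ?w \<mu>"
    if mu: "\<mu> \<in> local_polytope G ?A" for \<mu>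
  proof -
    \<comment> \<open>Overwriting first by \<open>x\<close> and then by \<open>x'\<close> fixes
      every node of the union without raising the energy. On the overlap the second overwriting
      wins, hence the precedence of \<open>x'\<close> in \<open>?w\<close>.\<close>
    let ?\<nu> = "overwrite_marginals G ?A B x \<mu>"
    have nu: "?\<nu> \<in> local_polytope G ?A"
      by (rule overwrite_in_local_polytope[OF mu A(1,2) x(1)])
    have "overwrite_marginals G ?A C x' ?\<nu> = indicator_marginals G ?A ?w"
      by (rule integral_marginals_eq_indicator[OF overwrite_in_local_polytope[OF nu A(1,3) x(2)]
            A(1) w]) (auto simp: overwrite_nodes_def)
    then show ?thesis
      using overwrite_identifiable_le[OF A(1,2) mu B(2), of ?w]
        overwrite_identifiable_le[OF A(1,3) nu C(2), of ?w] by simp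
  qed
  then show ?thesis
    using w indicator_in_local_polytope[OF A(1) w]
    by (simp add: relaxed_identifiable_def is_arg_min_linorder del: split_paired_All)
qed

text \<open>A finite nonempty family closed under binary unions contains its own union.\<close>

lemma ex_maximal_identifiable:
  assumes "B \<subseteq> nodes G" "relaxed_identifiable G B x"
  obtains U w where "U \<subseteq> nodes G" "relaxed_identifiable G U w"
    "\<And>B x. B \<subseteq> nodes G \<Longrightarrow> relaxed_identifiable G B x \<Longrightarrow> B \<subseteq> U"
proof -
  let ?F = "{B. B \<subseteq> nodes G \<and> (\<exists>x. relaxed_identifiable G B x)}"
  have "finite ?F"
    using finite_nodes by simp
  moreover have "?F \<noteq> {}"
    using assms by auto
  ultimately have "\<Union>?F \<in> ?F"
  proof (rule finite_Sup_in)
    show "sup B C \<in> ?F" if "B \<in> ?F" "C \<in> ?F" for B C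
      using that relaxed_identifiable_Un[of B _ C] by auto
  qed
  then obtain w where "\<Union>?F \<subseteq> nodes G" "relaxed_identifiable G (\<Union>?F) w"
    by blast
  then show ?thesis
    by (rule that) auto
qed

section \<open>Executions of the pruning algorithm\<close>

text \<open>Two node sets occur because a state pairs the pruned set \<open>A\<close> with a
  minimizer over the larger set \<open>A'\<close> from which it was pruned.\<close>

lemma integral_labeling_eq:
  assumes mu: "\<mu> \<in> local_polytope G A'" and A': "A' \<subseteq> nodes G" and A: "A \<subseteq> A'"
    and u: "u \<in> A" "node_marg \<mu> u a = 1"
  shows "integral_labeling G A \<mu> u = a"
proof -
  have "a \<in> labels G u"
    using u node_marg_eq_0[OF mu, of u a] by auto
  then have "(THE a. a \<in> labels G u \<and> node_marg \<mu> u a = 1) = a"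
    using u A node_marg_eq_0_of_one[OF mu A' _ u(2)]
    by (intro the_equality) (auto, metis subsetD zero_neq_one)
  then show ?thesis
    using u by (simp add: integral_labeling_def)
qed

lemma integral_labeling:
  assumes mu: "\<mu> \<in> local_polytope G A'" and A': "A' \<subseteq> nodes G" and A: "A \<subseteq> integral_nodes G A' \<mu>"
  shows "integral_labeling G A \<mu> \<in> labelings G A"
    and "u \<in> A \<Longrightarrow> node_marg \<mu> u (integral_labeling G A \<mu> u) = 1"
proof -
  have AA': "A \<subseteq> A'"
    using A by (auto simp: integral_nodes_def)
  have *: "\<exists>a\<in>labels G u. node_marg \<mu> u a = 1 \<and> integral_labeling G A \<mu> u = a" if "u \<in> A" for u
  proof -
    have "\<exists>a\<in>labels G u. node_marg \<mu> u a \<noteq> 0"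
      using sum_node_marg[OF mu, of u] that AA' by (metis sum.neutral subsetD zero_neq_one)
    moreover have "node_marg \<mu> u a \<in> {0, 1}" if "a \<in> labels G u" for a
      using A \<open>u \<in> A\<close> that unfolding integral_nodes_def by blast
    ultimately obtain a where "a \<in> labels G u" "node_marg \<mu> u a = 1"
      by blast
    then show ?thesis
      using integral_labeling_eq[OF mu A' AA' that] by blast
  qed
  then show "integral_labeling G A \<mu> \<in> labelings G A"
    by (fastforce simp: labelings_def PiE_iff integral_labeling_def)
  show "u \<in> A \<Longrightarrow> node_marg \<mu> u (integral_labeling G A \<mu> u) = 1"
    using * by blast
qed

lemma pruning_step_iff:
  "pruning_step G (A, \<mu>) (A', \<mu>') \<longleftrightarrow>
    is_arg_min (relaxed_test_energy G A (integral_labeling G A \<mu>)) (\<lambda>\<mu>. \<mu> \<in> local_polytope G A) \<mu>' \<and>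
    A' = integral_nodes G A \<mu>' -
      {u \<in> boundary_nodes G A. node_marg \<mu>' u (integral_labeling G A \<mu> u) \<noteq> 1}"
  by (simp add: pruning_step_def Let_def)

lemma pruning_step_subset: "pruning_step G s s' \<Longrightarrow> fst s' \<subseteq> fst s"
  by (cases s; cases s') (auto simp: pruning_step_iff integral_nodes_def)

text \<open>A state does not record the node set over which its minimizer was taken. It is all nodes
  at the start, and the previous node set after a step.\<close>

lemma reachable_integral:
  assumes "pruning_reachable G s"
  shows "\<exists>A'. snd s \<in> local_polytope G A' \<and> A' \<subseteq> nodes G \<and> fst s \<subseteq> integral_nodes G A' (snd s)"
  using assms
proof induction
  case (init s)
  then show ?case
    by (intro exI[of _ "nodes G"]) (auto simp: pruning_init_def is_arg_min_def)
next
  case (step s s')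
  then have "fst s \<subseteq> nodes G"
    by (auto simp: integral_nodes_def)
  with step.hyps(2) show ?case
    by (intro exI[of _ "fst s"], cases s; cases s') (auto simp: pruning_step_iff is_arg_min_def)
qed

lemma reachable_subset: "pruning_reachable G s \<Longrightarrow> fst s \<subseteq> nodes G"
  using reachable_integral by (fastforce simp: integral_nodes_def)

section \<open>Progress, termination and outputs\<close>

lemma ex_pruning_init: "\<exists>s. pruning_init G s"
  using ex_arg_min_local_polytope[OF order_refl continuous_on_relaxed_energy]
  by (simp add: pruning_init_def)

lemma ex_pruning_step: "fst s \<subseteq> nodes G \<Longrightarrow> \<exists>s'. pruning_step G s s'"
  using ex_arg_min_local_polytope[OF _ continuous_on_relaxed_test_energy, of "fst s"]
  by (cases s) (auto simp: pruning_step_iff)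

lemma no_infinite_execution:
  fixes S :: "nat \<Rightarrow> 'v set \<times> ('v, 'l) marginals"
  assumes init: "pruning_init G (S 0)"
    and step: "\<And>t. pruning_step G (S t) (S (Suc t)) \<and> fst (S (Suc t)) \<noteq> fst (S t)"
  shows False
proof -
  have fin: "finite (fst (S t))" for t
  proof (rule finite_subset[OF reachable_subset finite_nodes])
    show "pruning_reachable G (S t)"
      by (induction t) (use init step pruning_reachable.intros in blast)+
  qed
  have decrease: "card (fst (S (Suc t))) < card (fst (S t))" for t
    using step[of t] pruning_step_subset[of "S t" "S (Suc t)"] fin[of t]
    by (intro psubset_card_mono) (auto simp: psubset_eq)
  \<comment> \<open>Every step that does not stop removes at least one node.\<close>
  have "card (fst (S t)) + t \<le> card (fst (S 0))" for t
  proof (induction t)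
    case (Suc t)
    then show ?case
      using decrease[of t] by linarith
  qed simp
  from this[of "Suc (card (fst (S 0)))"] show False
    by simp
qed

lemma pruning_terminates: "pruning_terminates G"
  unfolding pruning_terminates_def
  using ex_pruning_init ex_pruning_step reachable_subset no_infinite_execution by blast

text \<open>The stopping condition says that every node of \<open>A\<close> is integral in the last
  minimizer and that no boundary label has changed. So this minimizer is \<delta>(x), and the test
  energy it minimizes, formed with the previous labeling, is the one formed with
  \<open>x\<close>.\<close>

lemma output_identifiable:
  assumes "pruning_output G A x"
  shows "A \<subseteq> nodes G" "relaxed_identifiable G A x"
proof -
  obtain \<mu> \<mu>' where reach: "pruning_reachable G (A, \<mu>)" and step: "pruning_step G (A, \<mu>) (A, \<mu>')"
    and x: "x = integral_labeling G A \<mu>'"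
    using assms by (auto simp: pruning_output_def)
  show A: "A \<subseteq> nodes G"
    using reachable_subset[OF reach] by simp
  let ?y = "integral_labeling G A \<mu>"
  have min: "is_arg_min (relaxed_test_energy G A ?y) (\<lambda>\<mu>. \<mu> \<in> local_polytope G A) \<mu>'"
    and stable: "A = integral_nodes G A \<mu>' - {u \<in> boundary_nodes G A. node_marg \<mu>' u (?y u) \<noteq> 1}"
    using step by (auto simp: pruning_step_iff)
  have mu': "\<mu>' \<in> local_polytope G A" and int: "A \<subseteq> integral_nodes G A \<mu>'"
    using min stable by (auto simp: is_arg_min_def)
  have one: "node_marg \<mu>' u (x u) = 1" if "u \<in> A" for u
    using integral_labeling(2)[OF mu' A int that] x by simp
  have xl: "x \<in> labelings G A"
    using integral_labeling(1)[OF mu' A int] x by simp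
  have "?y u = x u" if "u \<in> boundary_nodes G A" for u
  proof -
    have "u \<in> A"
      using that by (auto simp: boundary_nodes_def)
    moreover from this have "node_marg \<mu>' u (?y u) = 1"
      using that stable by blast
    ultimately show ?thesis
      using integral_labeling_eq[OF mu' A order_refl] x by simp
  qed
  then have "relaxed_test_energy G A ?y = relaxed_test_energy G A x"
    by (rule relaxed_test_energy_cong)
  then show "relaxed_identifiable G A x"
    using min xl integral_marginals_eq_indicator[OF mu' A xl one]
    by (simp add: relaxed_identifiable_def)
qed

section \<open>Node sets that survive pruning\<close>

lemma fixed_subset_integral_nodes:
  assumes mu: "\<mu> \<in> local_polytope G A" and A: "A \<subseteq> nodes G" and U: "U \<subseteq> A"
    and one: "\<And>u. u \<in> U \<Longrightarrow> node_marg \<mu> u (w u) = 1"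
  shows "U \<subseteq> integral_nodes G A \<mu>"
proof
  fix u assume u: "u \<in> U"
  have "node_marg \<mu> u a \<in> {0, 1}" for a
    using node_marg_eq_0_of_one[OF mu A _ one[OF u], of a] one[OF u] u U by (cases "a = w u") auto
  then show "u \<in> integral_nodes G A \<mu>"
    using u U by (auto simp: integral_nodes_def)
qed

text \<open>A node is pruned only if it becomes fractional or if it is a boundary node whose label
  changes. Taking the label \<open>w u\<close> in both successive minimizers excludes both.\<close>

lemma step_keeps_fixed:
  assumes reach: "pruning_reachable G (A, \<mu>)" and step: "pruning_step G (A, \<mu>) (A', \<mu>')"
    and U: "U \<subseteq> A"
    and one: "\<And>u. u \<in> U \<Longrightarrow> node_marg \<mu> u (w u) = 1"
    and one': "\<And>u. u \<in> U \<Longrightarrow> node_marg \<mu>' u (w u) = 1"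
  shows "U \<subseteq> A'"
proof -
  obtain C where C: "\<mu> \<in> local_polytope G C" "C \<subseteq> nodes G" "A \<subseteq> C"
    using reachable_integral[OF reach] by (auto simp: integral_nodes_def)
  have "integral_labeling G A \<mu> u = w u" if "u \<in> U" for u
    using integral_labeling_eq[OF C _ one] that U by auto
  moreover have "U \<subseteq> integral_nodes G A \<mu>'"
    using step reachable_subset[OF reach] U one'
    by (intro fixed_subset_integral_nodes[where w = w]) (auto simp: pruning_step_iff is_arg_min_def)
  ultimately show ?thesis
    using step one' by (auto simp: pruning_step_iff)
qed

text \<open>Continues the execution by choosing minimizers overwritten with \<open>w\<close> on
  \<open>U\<close>, which keeps the invariant on \<open>U\<close>. The induction ends because a step
  that does not stop shrinks the node set.\<close>

lemma ex_output_superset: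
  assumes "pruning_reachable G (A, \<mu>)" "U \<subseteq> A" "relaxed_identifiable G U w"
    and "\<And>u. u \<in> U \<Longrightarrow> node_marg \<mu> u (w u) = 1"
  shows "\<exists>A' x. pruning_output G A' x \<and> U \<subseteq> A'"
  using assms
proof (induction "card A" arbitrary: A \<mu> rule: less_induct)
  case less
  let ?x = "integral_labeling G A \<mu>"
  have A: "A \<subseteq> nodes G"
    using reachable_subset[OF less.prems(1)] by simp
  obtain \<nu> where nu: "is_arg_min (relaxed_test_energy G A ?x) (\<lambda>\<mu>. \<mu> \<in> local_polytope G A) \<nu>"
    using ex_arg_min_local_polytope[OF A continuous_on_relaxed_test_energy] by blast
  define \<mu>' where "\<mu>' = overwrite_marginals G A U w \<nu>"
  have one': "node_marg \<mu>' u (w u) = 1" if "u \<in> U" for u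
    using that by (simp add: \<mu>'_def)
  obtain A' where step: "pruning_step G (A, \<mu>) (A', \<mu>')"
    using arg_min_overwrite[OF A less.prems(2,3) nu] by (auto simp: pruning_step_iff \<mu>'_def)
  have U: "U \<subseteq> A'"
    by (rule step_keeps_fixed[OF less.prems(1) step less.prems(2,4) one'])
  show ?case
  proof (cases "A' = A")
    case True
    then show ?thesis
      using less.prems(1) step U unfolding pruning_output_def by blast
  next
    case False
    then have "card A' < card A"
      using pruning_step_subset[OF step] finite_subset[OF A finite_nodes]
      by (intro psubset_card_mono) auto
    moreover have "pruning_reachable G (A', \<mu>')"
      using pruning_reachable.step[OF less.prems(1) step] False by simp
    ultimately show ?thesis
      using less.hyps U less.prems(3) one' by blast
  qed
qed

lemma ex_output_superset_identifiable:
  assumes U: "U \<subseteq> nodes G" and id: "relaxed_identifiable G U w"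
  shows "\<exists>A x. pruning_output G A x \<and> U \<subseteq> A"
proof -
  \<comment> \<open>Over all nodes the test energy is the relaxed energy, so
    \<open>arg_min_overwrite\<close> also yields an admissible start.\<close>
  obtain \<nu> where "is_arg_min (relaxed_test_energy G (nodes G) w)
      (\<lambda>\<mu>. \<mu> \<in> local_polytope G (nodes G)) \<nu>"
    using ex_arg_min_local_polytope[OF order_refl continuous_on_relaxed_test_energy] by blast
  define \<mu> where "\<mu> = overwrite_marginals G (nodes G) U w \<nu>"
  have min: "is_arg_min (relaxed_energy G (nodes G)) (\<lambda>\<mu>. \<mu> \<in> local_polytope G (nodes G)) \<mu>"
    using arg_min_overwrite[OF order_refl U id \<open>is_arg_min _ _ \<nu>\<close>]
    by (simp add: \<mu>_def relaxed_test_energy_nodes)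
  have one: "node_marg \<mu> u (w u) = 1" if "u \<in> U" for u
    using that by (simp add: \<mu>_def)
  have "pruning_reachable G (integral_nodes G (nodes G) \<mu>, \<mu>)"
    using min by (intro pruning_reachable.init) (simp add: pruning_init_def)
  moreover have "U \<subseteq> integral_nodes G (nodes G) \<mu>"
    using min one U by (intro fixed_subset_integral_nodes[where w = w]) (auto simp: is_arg_min_def)
  ultimately show ?thesis
    using ex_output_superset id one by blast
qed

lemma reachable_superset_of_unique_minimizer:
  assumes B: "B \<subseteq> nodes G" and id: "relaxed_identifiable G B x"
    and unique: "\<And>\<mu>. is_arg_min (relaxed_test_energy G B x) (\<lambda>\<mu>. \<mu> \<in> local_polytope G B) \<mu> \<Longrightarrow>
      \<mu> = indicator_marginals G B x"
    and reach: "pruning_reachable G s"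
  shows "B \<subseteq> fst s \<and> (\<forall>u\<in>B. node_marg (snd s) u (x u) = 1)"
proof -
  \<comment> \<open>Both \<open>A\<close> and the test labeling \<open>y\<close> are arbitrary, so
    this covers the initialization and every later step, whichever minimizer is taken.\<close>
  have one: "node_marg \<mu> u (x u) = 1"
    if "A \<subseteq> nodes G" "B \<subseteq> A" "u \<in> B"
      "is_arg_min (relaxed_test_energy G A y) (\<lambda>\<mu>. \<mu> \<in> local_polytope G A) \<mu>" for A y \<mu> u
  proof -
    have "node_marg (restrict_marginals B \<mu>) u (x u) = node_marg (indicator_marginals G B x) u (x u)"
      using unique[OF arg_min_restrict[OF that(1,2) id that(4)]] by simp
    then show ?thesis
      using that by (simp add: restrict_marginals_def indicator_marginals_def)
  qed
  from reach show ?thesis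
  proof induction
    case (init s)
    then have min: "is_arg_min (relaxed_test_energy G (nodes G) x)
        (\<lambda>\<mu>. \<mu> \<in> local_polytope G (nodes G)) (snd s)"
      and s: "fst s = integral_nodes G (nodes G) (snd s)"
      by (auto simp: pruning_init_def relaxed_test_energy_nodes)
    have "B \<subseteq> fst s"
      unfolding s using min B one[OF order_refl B _ min]
      by (intro fixed_subset_integral_nodes[where w = x]) (auto simp: is_arg_min_def)
    then show ?case
      using one[OF order_refl B _ min] by blast
  next
    case (step s s')
    obtain A \<mu> A' \<mu>' where s: "s = (A, \<mu>)" "s' = (A', \<mu>')"
      by (cases s, cases s')
    have one': "node_marg \<mu>' u (x u) = 1" if "u \<in> B" for u
    proof (rule one[OF _ _ that])
      show "A \<subseteq> nodes G" "B \<subseteq> A"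
        using reachable_subset[OF step.hyps(1)] step.IH by (simp_all add: s)
      show "is_arg_min (relaxed_test_energy G A (integral_labeling G A \<mu>))
          (\<lambda>\<mu>. \<mu> \<in> local_polytope G A) \<mu>'"
        using step.hyps(2) by (simp add: s pruning_step_iff)
    qed
    moreover have "B \<subseteq> A'"
      using step.IH by (intro step_keeps_fixed[OF step.hyps(1,2)[unfolded s], where w = x])
        (auto simp: s one')
    ultimately show ?case
      by (simp add: s)
  qed
qed

end

text \<open>With ties in the linear programs an execution may prune \<open>B\<close> even though no
  other labeling on \<open>B\<close> is identifiable. Covering \<open>B\<close> is therefore claimed
  for some execution, and for every execution when \<delta>(x0) is the only minimizer on
  \<open>B\<close>.\<close>

theorem theorem2:
  fixes G :: "('v, 'l) graphical_model"
    and B :: "'v set" and x0 :: "'v \<Rightarrow> 'l"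
  assumes "wf_graphical_model G"
    and "B \<subseteq> nodes G"
    and "relaxed_identifiable G B x0"
    and "\<forall>x'. relaxed_identifiable G B x' \<longrightarrow> x' = x0"
  shows "pruning_terminates G \<and>
    (\<forall>A x. pruning_output G A x \<longrightarrow> A \<subseteq> nodes G \<and> persistent G A x) \<and>
    (\<exists>A x. pruning_output G A x \<and> B \<subseteq> A \<and>
       (\<forall>B' x'. B' \<subseteq> nodes G \<and> strongly_persistent G B' x' \<and> relaxed_identifiable G B' x'
          \<longrightarrow> B' \<subseteq> A)) \<and>
    ((\<forall>\<mu>. is_arg_min (relaxed_test_energy G B x0) (\<lambda>\<mu>. \<mu> \<in> local_polytope G B) \<mu>
          \<longrightarrow> \<mu> = indicator_marginals G B x0) \<longrightarrow>
       (\<forall>A x. pruning_output G A x \<longrightarrow> B \<subseteq> A))"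
proof -
  interpret wf_graphical_model G
    by fact
  \<comment> \<open>An output containing the largest identifiable set contains \<open>B\<close> and
    all the sets \<open>B'\<close> at once.\<close>
  obtain U w where U: "U \<subseteq> nodes G" "relaxed_identifiable G U w"
    and max: "\<And>B x. B \<subseteq> nodes G \<Longrightarrow> relaxed_identifiable G B x \<Longrightarrow> B \<subseteq> U"
    using ex_maximal_identifiable[OF assms(2,3)] by metis
  obtain A x where out: "pruning_output G A x" "U \<subseteq> A"
    using ex_output_superset_identifiable[OF U] by blast
  have unique: "B \<subseteq> A" if unique_min: "\<forall>\<mu>. is_arg_min (relaxed_test_energy G B x0)
      (\<lambda>\<mu>. \<mu> \<in> local_polytope G B) \<mu> \<longrightarrow> \<mu> = indicator_marginals G B x0"
    and out: "pruning_output G A x" for A x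
  proof -
    obtain \<mu> where reach: "pruning_reachable G (A, \<mu>)"
      using out unfolding pruning_output_def by blast
    then show ?thesis
      using reachable_superset_of_unique_minimizer[OF assms(2,3) _ reach] unique_min by simp
  qed
  show ?thesis
  proof (intro conjI allI impI exI[of _ A] exI[of _ x])
    show "B \<subseteq> A"
      using max[OF assms(2,3)] out by blast
    show "B' \<subseteq> A" if "B' \<subseteq> nodes G \<and> strongly_persistent G B' x' \<and> relaxed_identifiable G B' x'"
      for B' x'
      using max that out by blast
    show "persistent G A x" "A \<subseteq> nodes G" if "pruning_output G A x" for A x
      using output_identifiable[OF that] relaxed_identifiable_imp_persistent by auto
  qed (use pruning_terminates out(1) unique in auto)
qed

end
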